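(* Let $J$ be an almost complex structure on $A$ and $(\square,\sigma^{-1})$ a right bimodule covariant derivative on $\Omega^1A$. Suppose that a) $\wedge:\Omega^{1,0}A\otimes_A\Omega^{0,1}A\to\Omega^{1,1}A$ is an isomorphism, b) $(J\otimes\mathrm{id})\square=\square\,J:\Omega^1A\to\Omega^1A\otimes_A\Omega^1A$, c) $\pi^{1,1}\mathrm{Tor}_R:\Omega^1A\to\Omega^{1,1}A$ vanishes, where $\mathrm{Tor}_R=\mathrm d+\wedge\,\square:\Omega^1A\to\Omega^2A$. If $v\in\mathrm{Vec}^{1,0}A$ satisfies $(\pi^{0,1}\otimes\mathrm{id})\square v=0$, then whenever $a\in A$ is holomorphic (i.e. $\bar\partial a=0$), so is $\mathrm{ev}(v\otimes\mathrm da)$.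
   Context: $A$ is a unital $*$-algebra over $\mathbb C$ with a differential graded algebra $(\Omega A=\oplus_n\Omega^nA,\mathrm d,\wedge)$, $\Omega^0A=A$, $\mathrm d^2=0$, graded Leibniz rule, generated over $A$ by $\Omega^1A$, with $\Omega^1A=A.\mathrm dA$, such that $a.\mathrm db\mapsto\mathrm db^*.a^*$ is a well defined star operation on $\Omega^1A$ extending to all $\Omega^nA$. $\Omega^1A$ is finitely generated projective as a right $A$-module. An almost complex structure is an $A$-bimodule map $J:\Omega^1A\to\Omega^1A$ with $J(\xi^* )=J(\xi)^*$, $J^2=-\mathrm{id}$, such that $J\otimes\mathrm{id}^{\otimes n-1}+\dots+\mathrm{id}^{\otimes n-1}\otimes J$ descends via $\wedge$ to a well defined map $J:\Omega^nA\to\Omega^nA$ for each $n$. $\Omega^{p,q}A$ ($p,q\ge0$) is the $\mathrm i(p-q)$-eigenspace of $J$ in $\Omega^{p+q}A$, $\pi^{p,q}:\Omega^{p+q}A\to\Omega^{p,q}A$ the projection, $\partial=\pi^{p+1,q}\mathrm d$ and $\bar\partial=\pi^{p,q+1}\mathrm d$ on $\Omega^{p,q}A$. $\mathrm{Vec}A=\mathrm{Hom}_A(\Omega^1A,A)$ (right module maps), a bimodule by $(a.v)(\xi)=a\,v(\xi)$, $(v.a)(\xi)=v(a\xi)$; $J(v)=v\circ J$ on $\mathrm{Vec}A$, and $\mathrm{Vec}^{1,0}A$ is its $+\mathrm i$ eigenspace. $\mathrm{ev}:\mathrm{Vec}A\otimes_A\Omega^1A\to A$ is evaluation. A right bimodule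 covariant derivative: $\square:\Omega^1A\to\Omega^1A\otimes_A\Omega^1A$ with $\square(\xi a)=\square(\xi)a+\xi\otimes\mathrm da$, $\square(a\xi)=a\square(\xi)+\sigma^{-1}(\mathrm da\otimes\xi)$, $\sigma^{-1}$ a bimodule map on $\Omega^1A\otimes_A\Omega^1A$ (not assumed invertible). $\square:\mathrm{Vec}A\to\Omega^1A\otimes_A\mathrm{Vec}A$ is the dual left covariant derivative, determined by $\mathrm d\circ\mathrm{ev}=(\mathrm{id}\otimes\mathrm{ev})(\square\otimes\mathrm{id})+(\mathrm{ev}\otimes\mathrm{id})(\mathrm{id}\otimes\square)$ on $\mathrm{Vec}A\otimes_A\Omega^1A$. *)

theory Defs
  imports Complex_Main "HOL-Library.Poly_Mapping" "HOL-Library.Set_Algebras"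
    "HOL-Library.Function_Algebras"
begin

section \<open>Bimodules and their tensor products\<close>

text \<open>
  All bimodules are over a subring \<open>A\<close> of a unital ring of type \<open>'w\<close>, passed as the set \<open>A\<close>.
  The addition of a bimodule is that of its element type. The sort \<open>{ring, monoid_mult}\<close>, used
  instead of \<open>ring_1\<close>, does not exclude the zero ring.
\<close>

record ('w, 'm) bimod =
  car  :: "'m set"
  lact :: "'w \<Rightarrow> 'm \<Rightarrow> 'm"
  ract :: "'m \<Rightarrow> 'w \<Rightarrow> 'm"

definition additive_map :: "('w, 'm::plus) bimod \<Rightarrow> ('w, 'n::plus) bimod \<Rightarrow> ('m \<Rightarrow> 'n) \<Rightarrow> bool" where
  "additive_map M N f \<longleftrightarrow>
     (\<forall>x\<in>car M. f x \<in> car N) \<and> (\<forall>x\<in>car M. \<forall>y\<in>car M. f (x + y) = f x + f y)"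

definition right_map ::
    "'w set \<Rightarrow> ('w, 'm::plus) bimod \<Rightarrow> ('w, 'n::plus) bimod \<Rightarrow> ('m \<Rightarrow> 'n) \<Rightarrow> bool" where
  "right_map A M N f \<longleftrightarrow>
     additive_map M N f \<and> (\<forall>x\<in>car M. \<forall>a\<in>A. f (ract M x a) = ract N (f x) a)"

definition bimod_map ::
    "'w set \<Rightarrow> ('w, 'm::plus) bimod \<Rightarrow> ('w, 'n::plus) bimod \<Rightarrow> ('m \<Rightarrow> 'n) \<Rightarrow> bool" where
  "bimod_map A M N f \<longleftrightarrow>
     right_map A M N f \<and> (\<forall>a\<in>A. \<forall>x\<in>car M. f (lact M a x) = lact N a (f x))"

definition bimod_iso ::
    "'w set \<Rightarrow> ('w, 'm::plus) bimod \<Rightarrow> ('w, 'n::plus) bimod \<Rightarrow> ('m \<Rightarrow> 'n) \<Rightarrow> bool" where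
  "bimod_iso A M N f \<longleftrightarrow> bimod_map A M N f \<and> bij_betw f (car M) (car N)"

definition free_bimod :: "'w::{ring,monoid_mult} set \<Rightarrow> nat \<Rightarrow> ('w, nat \<Rightarrow> 'w) bimod" where
  "free_bimod A n =
     \<lparr>car = {f. (\<forall>i<n. f i \<in> A) \<and> (\<forall>i\<ge>n. f i = 0)},
      lact = (\<lambda>a f i. a * f i), ract = (\<lambda>f a i. f i * a)\<rparr>"

definition right_submodule :: "'w set \<Rightarrow> ('w, 'm::{plus,zero}) bimod \<Rightarrow> 'm set \<Rightarrow> bool" where
  "right_submodule A M P \<longleftrightarrow> P \<subseteq> car M \<and> 0 \<in> P \<and>
     (\<forall>x\<in>P. \<forall>y\<in>P. x + y \<in> P) \<and> (\<forall>x\<in>P. \<forall>a\<in>A. ract M x a \<in> P)"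

text \<open>
  Finitely generated projective as a right module: isomorphic to a direct summand \<open>P\<close> of some
  \<open>A\<^sup>n = P \<oplus> Q\<close>. Here \<open>P + Q\<close> is the elementwise sum of sets, and \<open>{0}\<close> contains the zero function.
\<close>

definition fgp_right :: "'w::{ring,monoid_mult} set \<Rightarrow> ('w, 'm::plus) bimod \<Rightarrow> bool" where
  "fgp_right A M \<longleftrightarrow>
     (\<exists>n P Q h. right_submodule A (free_bimod A n) P \<and> right_submodule A (free_bimod A n) Q \<and>
        P \<inter> Q = {0} \<and> P + Q = car (free_bimod A n) \<and>
        right_map A (free_bimod A n \<lparr>car := P\<rparr>) M h \<and> bij_betw h P (car M))"

text \<open>
  \<open>M \<otimes>\<^sub>A N\<close> is the free abelian group on \<open>M \<times> N\<close> modulo the subgroup \<open>tensor_rel A M N\<close>. Its elements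
  are the cosets \<open>x +o tensor_rel A M N\<close>; their addition is the elementwise addition of sets, and
  the zero element is \<open>tensor_rel A M N\<close> itself (not \<open>0 :: _ set\<close>, which is \<open>{0}\<close>).
\<close>

type_synonym ('m, 'n) tensor = "(('m \<times> 'n) \<Rightarrow>\<^sub>0 int) set"

definition tensor_rel ::
    "'w set \<Rightarrow> ('w, 'm::plus) bimod \<Rightarrow> ('w, 'n::plus) bimod \<Rightarrow> (('m \<times> 'n) \<Rightarrow>\<^sub>0 int) set" where
  "tensor_rel A M N = module.span frag_cmul
     ({frag_of (x + x', y) - frag_of (x, y) - frag_of (x', y) |x x' y.
          x \<in> car M \<and> x' \<in> car M \<and> y \<in> car N} \<union>
      {frag_of (x, y + y') - frag_of (x, y) - frag_of (x, y') |x y y'.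
          x \<in> car M \<and> y \<in> car N \<and> y' \<in> car N} \<union>
      {frag_of (ract M x a, y) - frag_of (x, lact N a y) |x a y.
          x \<in> car M \<and> a \<in> A \<and> y \<in> car N})"

definition tensor_zero ::
    "'w set \<Rightarrow> ('w, 'm::plus) bimod \<Rightarrow> ('w, 'n::plus) bimod \<Rightarrow> ('m, 'n) tensor" where
  "tensor_zero A M N = tensor_rel A M N"

definition tens ::
    "'w set \<Rightarrow> ('w, 'm::plus) bimod \<Rightarrow> ('w, 'n::plus) bimod \<Rightarrow> 'm \<Rightarrow> 'n \<Rightarrow> ('m, 'n) tensor" where
  "tens A M N x y = frag_of (x, y) +o tensor_rel A M N"

text \<open>
  The map \<open>f \<otimes> g\<close> into \<open>M \<otimes>\<^sub>A N\<close>, computed on a representative. The modules are those of the target.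
\<close>

definition tensor_map ::
    "'w set \<Rightarrow> ('w, 'm::plus) bimod \<Rightarrow> ('w, 'n::plus) bimod \<Rightarrow> ('k \<Rightarrow> 'm) \<Rightarrow> ('l \<Rightarrow> 'n) \<Rightarrow>
     ('k, 'l) tensor \<Rightarrow> ('m, 'n) tensor" where
  "tensor_map A M N f g X =
     frag_extend (\<lambda>(x, y). frag_of (f x, g y)) (SOME z. z \<in> X) +o tensor_rel A M N"

definition tensor ::
    "'w set \<Rightarrow> ('w, 'm::plus) bimod \<Rightarrow> ('w, 'n::plus) bimod \<Rightarrow> ('w, ('m, 'n) tensor) bimod" where
  "tensor A M N =
     \<lparr>car = {z +o tensor_rel A M N |z. Poly_Mapping.keys z \<subseteq> car M \<times> car N},
      lact = (\<lambda>a. tensor_map A M N (lact M a) id),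
      ract = (\<lambda>X a. tensor_map A M N id (\<lambda>y. ract N y a) X)\<rparr>"


section \<open>Differential calculi with star operation\<close>

text \<open>
  The type \<open>'w\<close> is the total algebra \<open>\<Omega>A = \<Oplus>\<^sub>n \<Omega>\<^sup>nA\<close>, with \<open>\<and>\<close> and all \<open>A\<close>-actions given by the ring
  multiplication, and \<open>forms D n\<close> is \<open>\<Omega>\<^sup>nA\<close>. In particular \<open>A = forms D 0\<close>.
\<close>

record 'w dga =
  smul  :: "complex \<Rightarrow> 'w \<Rightarrow> 'w"
  forms :: "nat \<Rightarrow> 'w set"
  dif   :: "'w \<Rightarrow> 'w"
  star  :: "'w \<Rightarrow> 'w"

definition Omega :: "('w::{ring,monoid_mult}) dga \<Rightarrow> nat \<Rightarrow> ('w, 'w) bimod" where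
  "Omega D n = \<lparr>car = forms D n, lact = (*), ract = (*)\<rparr>"

locale star_calculus =
  fixes D :: "('w::{ring,monoid_mult}) dga"
  assumes vector_space: "vector_space (smul D)"
    and smul_mult_left: "smul D c (x * y) = smul D c x * y"
    and smul_mult_right: "smul D c (x * y) = x * smul D c y"
    and subspace_forms: "module.subspace (smul D) (forms D n)"
    and direct_sum: "\<exists>!f. (\<forall>n. f n \<in> forms D n) \<and> finite {n. f n \<noteq> 0} \<and> x = (\<Sum>n | f n \<noteq> 0. f n)"
    and one_forms: "1 \<in> forms D 0"
    and mult_forms: "x \<in> forms D m \<Longrightarrow> y \<in> forms D n \<Longrightarrow> x * y \<in> forms D (m + n)"
    and dif_linear: "Vector_Spaces.linear (smul D) (smul D) (dif D)"
    and dif_forms: "x \<in> forms D n \<Longrightarrow> dif D x \<in> forms D (Suc n)"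
    and dif_dif: "dif D (dif D x) = 0"
    and leibniz: "x \<in> forms D n \<Longrightarrow> dif D (x * y) = dif D x * y + smul D ((-1) ^ n) (x * dif D y)"
    and generated: "forms D n = module.span (smul D)
          {a * prod_list xs |a xs. a \<in> forms D 0 \<and> set xs \<subseteq> forms D 1 \<and> length xs = n}"
    and one_forms_exact: "forms D 1 = module.span (smul D)
          {a * dif D b |a b. a \<in> forms D 0 \<and> b \<in> forms D 0}"
    and star_add: "star D (x + y) = star D x + star D y"
    and star_smul: "star D (smul D c x) = smul D (cnj c) (star D x)"
    and star_star: "star D (star D x) = x"
    and star_forms: "x \<in> forms D n \<Longrightarrow> star D x \<in> forms D n"
    and star_mult: "x \<in> forms D m \<Longrightarrow> y \<in> forms D n \<Longrightarrow>
          star D (x * y) = smul D ((-1) ^ (m * n)) (star D y * star D x)"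
    and star_dif: "a \<in> forms D 0 \<Longrightarrow> b \<in> forms D 0 \<Longrightarrow>
          star D (a * dif D b) = dif D (star D b) * star D a"
    and fgp: "fgp_right (forms D 0) (Omega D 1)"

text \<open>
  The map on \<open>M \<otimes>\<^sub>A N\<close> induced by a balanced biadditive \<open>f\<close> with values in \<open>\<Omega>A\<close>, computed on a
  representative.
\<close>

definition tensor_lift ::
    "('w::{ring,monoid_mult}) dga \<Rightarrow> ('m \<Rightarrow> 'n \<Rightarrow> 'w) \<Rightarrow> ('m, 'n) tensor \<Rightarrow> 'w" where
  "tensor_lift D f X =
     (let z = (SOME z. z \<in> X)
      in \<Sum>p\<in>Poly_Mapping.keys z. smul D (of_int (Poly_Mapping.lookup z p)) (f (fst p) (snd p)))"

definition wedge :: "('w::{ring,monoid_mult}) dga \<Rightarrow> ('w, 'w) tensor \<Rightarrow> 'w" where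
  "wedge D = tensor_lift D (*)"


section \<open>Almost complex structures\<close>

text \<open>
  \<open>K\<close> is the map on \<open>\<Omega>\<^sup>nA\<close> to which \<open>J \<otimes> id \<otimes> \<dots> \<otimes> id + \<dots> + id \<otimes> \<dots> \<otimes> id \<otimes> J\<close> descends along \<open>\<and>\<close>,
  written out on elementary tensors. The coefficient \<open>a\<close> matters only for \<open>n = 0\<close>, where it
  makes \<open>K\<close> zero on \<open>A\<close> (the empty sum).
\<close>

definition descends_to ::
    "('w::{ring,monoid_mult}) dga \<Rightarrow> ('w \<Rightarrow> 'w) \<Rightarrow> nat \<Rightarrow> ('w \<Rightarrow> 'w) \<Rightarrow> bool" where
  "descends_to D J n K \<longleftrightarrow> additive_map (Omega D n) (Omega D n) K \<and>
     (\<forall>a\<in>forms D 0. \<forall>xs. set xs \<subseteq> forms D 1 \<and> length xs = n \<longrightarrow>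
        K (a * prod_list xs) = a * (\<Sum>i<n. prod_list (xs[i := J (xs ! i)])))"

definition almost_complex :: "('w::{ring,monoid_mult}) dga \<Rightarrow> ('w \<Rightarrow> 'w) \<Rightarrow> bool" where
  "almost_complex D J \<longleftrightarrow>
     bimod_map (forms D 0) (Omega D 1) (Omega D 1) J \<and>
     (\<forall>\<xi>\<in>forms D 1. J (star D \<xi>) = star D (J \<xi>)) \<and>
     (\<forall>\<xi>\<in>forms D 1. J (J \<xi>) = - \<xi>) \<and>
     (\<forall>n. \<exists>K. descends_to D J n K)"

text \<open>The choice is unique on \<open>forms D n\<close>, which is spanned by the products in \<open>descends_to\<close>.\<close>

definition J_forms :: "('w::{ring,monoid_mult}) dga \<Rightarrow> ('w \<Rightarrow> 'w) \<Rightarrow> nat \<Rightarrow> 'w \<Rightarrow> 'w" where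
  "J_forms D J n = (SOME K. descends_to D J n K)"

definition forms_pq :: "('w::{ring,monoid_mult}) dga \<Rightarrow> ('w \<Rightarrow> 'w) \<Rightarrow> nat \<Rightarrow> nat \<Rightarrow> 'w set" where
  "forms_pq D J p q =
     {x \<in> forms D (p + q). J_forms D J (p + q) x = smul D (\<i> * (of_nat p - of_nat q)) x}"

definition Omega_pq ::
    "('w::{ring,monoid_mult}) dga \<Rightarrow> ('w \<Rightarrow> 'w) \<Rightarrow> nat \<Rightarrow> nat \<Rightarrow> ('w, 'w) bimod" where
  "Omega_pq D J p q = \<lparr>car = forms_pq D J p q, lact = (*), ract = (*)\<rparr>"

text \<open>
  The projection onto \<open>\<Omega>\<^sup>p\<^sup>,\<^sup>qA\<close> along the other summands of \<open>\<Omega>\<^sup>nA = \<Oplus>\<^sub>r\<^sub>\<le>\<^sub>n \<Omega>\<^sup>r\<^sup>,\<^sup>n\<^sup>-\<^sup>rA\<close>, \<open>n = p + q\<close>.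
\<close>

definition proj_pq :: "('w::{ring,monoid_mult}) dga \<Rightarrow> ('w \<Rightarrow> 'w) \<Rightarrow> nat \<Rightarrow> nat \<Rightarrow> 'w \<Rightarrow> 'w" where
  "proj_pq D J p q x =
     (THE f. (\<forall>r\<le>p + q. f r \<in> forms_pq D J r (p + q - r)) \<and> (\<forall>r>p + q. f r = 0) \<and>
             x = (\<Sum>r\<le>p + q. f r)) p"

definition dbar :: "('w::{ring,monoid_mult}) dga \<Rightarrow> ('w \<Rightarrow> 'w) \<Rightarrow> nat \<Rightarrow> nat \<Rightarrow> 'w \<Rightarrow> 'w" where
  "dbar D J p q x = proj_pq D J p (q + 1) (dif D x)"

definition holomorphic :: "('w::{ring,monoid_mult}) dga \<Rightarrow> ('w \<Rightarrow> 'w) \<Rightarrow> 'w \<Rightarrow> bool" where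
  "holomorphic D J a \<longleftrightarrow> a \<in> forms D 0 \<and> dbar D J 0 0 a = 0"


section \<open>Vector fields\<close>

text \<open>A right module map \<open>v : \<Omega>\<^sup>1A \<rightarrow> A\<close> is represented by its extension by zero outside \<open>forms D 1\<close>.\<close>

definition Vec :: "('w::{ring,monoid_mult}) dga \<Rightarrow> ('w, 'w \<Rightarrow> 'w) bimod" where
  "Vec D =
     \<lparr>car = {v. right_map (forms D 0) (Omega D 1) (Omega D 0) v \<and> (\<forall>\<xi>. \<xi> \<notin> forms D 1 \<longrightarrow> v \<xi> = 0)},
      lact = (\<lambda>a v \<xi>. a * v \<xi>),
      ract = (\<lambda>v a \<xi>. if \<xi> \<in> forms D 1 then v (a * \<xi>) else 0)\<rparr>"

definition J_Vec ::
    "('w::{ring,monoid_mult}) dga \<Rightarrow> ('w \<Rightarrow> 'w) \<Rightarrow> ('w \<Rightarrow> 'w) \<Rightarrow> ('w \<Rightarrow> 'w)" where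
  "J_Vec D J v = (\<lambda>\<xi>. if \<xi> \<in> forms D 1 then v (J \<xi>) else 0)"

definition Vec10 :: "('w::{ring,monoid_mult}) dga \<Rightarrow> ('w \<Rightarrow> 'w) \<Rightarrow> ('w \<Rightarrow> 'w) set" where
  "Vec10 D J = {v \<in> car (Vec D). J_Vec D J v = (\<lambda>\<xi>. smul D \<i> (v \<xi>))}"

definition ev :: "('w::{ring,monoid_mult}) dga \<Rightarrow> ('w \<Rightarrow> 'w, 'w) tensor \<Rightarrow> 'w" where
  "ev D = tensor_lift D (\<lambda>v \<xi>. v \<xi>)"


section \<open>Covariant derivatives\<close>

definition right_bimod_cov_deriv ::
    "('w::{ring,monoid_mult}) dga \<Rightarrow> ('w \<Rightarrow> ('w, 'w) tensor) \<Rightarrow>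
     (('w, 'w) tensor \<Rightarrow> ('w, 'w) tensor) \<Rightarrow> bool" where
  "right_bimod_cov_deriv D nab sig \<longleftrightarrow>
     (let A = forms D 0; W = Omega D 1; T = tensor A W W in
        additive_map W T nab \<and>
        (\<forall>\<xi>\<in>car W. \<forall>a\<in>A. nab (\<xi> * a) = ract T (nab \<xi>) a + tens A W W \<xi> (dif D a)) \<and>
        (\<forall>\<xi>\<in>car W. \<forall>a\<in>A. nab (a * \<xi>) = lact T a (nab \<xi>) + sig (tens A W W (dif D a) \<xi>)) \<and>
        bimod_map A T T sig)"

definition left_cov_deriv_Vec ::
    "('w::{ring,monoid_mult}) dga \<Rightarrow> (('w \<Rightarrow> 'w) \<Rightarrow> ('w, 'w \<Rightarrow> 'w) tensor) \<Rightarrow> bool" where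
  "left_cov_deriv_Vec D nab \<longleftrightarrow>
     (let A = forms D 0; W = Omega D 1; V = Vec D; T = tensor A W V in
        additive_map V T nab \<and>
        (\<forall>a\<in>A. \<forall>v\<in>car V. nab (lact V a v) = tens A W V (dif D a) v + lact T a (nab v)))"

text \<open>
  The identity \<open>d \<circ> ev = (id \<otimes> ev)(\<nabla> \<otimes> id) + (ev \<otimes> id)(id \<otimes> \<nabla>)\<close> is stated on elementary
  tensors \<open>v \<otimes> \<xi>\<close>, as the two summands on the right are not separately defined on
  \<open>Vec A \<otimes>\<^sub>A \<Omega>\<^sup>1A\<close>. The identifications \<open>\<Omega>\<^sup>1A \<otimes>\<^sub>A A = \<Omega>\<^sup>1A = A \<otimes>\<^sub>A \<Omega>\<^sup>1A\<close> are made by multiplication.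
\<close>

definition dual_cov_deriv ::
    "('w::{ring,monoid_mult}) dga \<Rightarrow> ('w \<Rightarrow> ('w, 'w) tensor) \<Rightarrow>
     (('w \<Rightarrow> 'w) \<Rightarrow> ('w, 'w \<Rightarrow> 'w) tensor) \<Rightarrow> bool" where
  "dual_cov_deriv D nab nabV \<longleftrightarrow>
     left_cov_deriv_Vec D nabV \<and>
     (let A = forms D 0; W = Omega D 1; V = Vec D in
        \<forall>v\<in>car V. \<forall>\<xi>\<in>car W.
          dif D (ev D (tens A V W v \<xi>)) =
            tensor_lift D (\<lambda>\<omega> w. \<omega> * ev D (tens A V W w \<xi>)) (nabV v) +
            tensor_lift D (\<lambda>\<eta> \<zeta>. ev D (tens A V W v \<eta>) * \<zeta>) (nab \<xi>))"

definition torsion_R ::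
    "('w::{ring,monoid_mult}) dga \<Rightarrow> ('w \<Rightarrow> ('w, 'w) tensor) \<Rightarrow> 'w \<Rightarrow> 'w" where
  "torsion_R D nab \<xi> = dif D \<xi> + wedge D (nab \<xi>)"

end

(*
  Let xi = da be of type (1,0). Hypothesis b puts nabla xi into Omega^{1,0} tensor Omega^1. The product
  of its Omega^{1,0} tensor Omega^{1,0} part has type (2,0), so the vanishing of the (1,1) part of the
  torsion says that the product of its Omega^{1,0} tensor Omega^{0,1} part is zero, and by hypothesis a
  that part is itself zero. Since d ev(v tensor xi) = (id tensor ev)(nabla v tensor xi) +
  (ev tensor id)(v tensor nabla xi), its (0,1) part is the sum of a term that vanishes by the hypothesis
  on v and of ev applied to v and the part of nabla xi just shown to be zero.
*)

theory Submission
  imports Defs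
begin

section \<open>Tensor products through representatives in the free abelian group\<close>

interpretation frag: module frag_cmul
  by standard (simp_all add: frag_cmul_distrib frag_cmul_distrib2)

text \<open>A \<open>bimod\<close> record carries no axioms. Collected here are the closure
  properties that keep the generators of \<open>tensor_rel\<close> supported in
  \<open>car M \<times> car N\<close>.\<close>

definition tensor_closed ::
    "'w set \<Rightarrow> ('w, 'm::plus) bimod \<Rightarrow> ('w, 'n::plus) bimod \<Rightarrow> bool" where
  "tensor_closed A M N \<longleftrightarrow>
     (\<forall>x\<in>car M. \<forall>x'\<in>car M. x + x' \<in> car M) \<and> (\<forall>x\<in>car M. \<forall>a\<in>A. ract M x a \<in> car M) \<and>
     (\<forall>y\<in>car N. \<forall>y'\<in>car N. y + y' \<in> car N) \<and> (\<forall>a\<in>A. \<forall>y\<in>car N. lact N a y \<in> car N)"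

lemma subspace_tensor_rel: "frag.subspace (tensor_rel A M N)"
  by (simp add: tensor_rel_def)

lemma subspace_keys_subset: "frag.subspace {z. Poly_Mapping.keys z \<subseteq> S}"
  using keys_add by (fastforce simp: frag.subspace_def)

lemma keys_diff3_subset:
  assumes "p \<in> S" "q \<in> S" "r \<in> S"
  shows "Poly_Mapping.keys (frag_of p - frag_of q - frag_of r) \<subseteq> S"
  using keys_diff[of "frag_of p - frag_of q" "frag_of r"] keys_diff[of "frag_of p" "frag_of q"] assms
  by auto

lemma keys_diff2_subset:
  assumes "p \<in> S" "q \<in> S"
  shows "Poly_Mapping.keys (frag_of p - frag_of q) \<subseteq> S"
  using keys_diff[of "frag_of p" "frag_of q"] assms by auto

text \<open>Closedness puts the support of each generator in the product of the carriers, and the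
  formal sums supported there form a subgroup.\<close>

lemma keys_tensor_rel:
  assumes "tensor_closed A M N" "r \<in> tensor_rel A M N"
  shows "Poly_Mapping.keys r \<subseteq> car M \<times> car N"
  using assms(2) unfolding tensor_rel_def
proof (induction rule: frag.span_induct)
  case base
  show ?case by (rule subspace_keys_subset)
next
  case (step x)
  then show ?case
    using assms(1) unfolding tensor_closed_def
    by (elim UnE CollectE exE conjE; hypsubst; intro keys_diff3_subset keys_diff2_subset; simp)
qed

lemma coset_self: "u \<in> u +o tensor_rel A M N"
  using frag.subspace_0[OF subspace_tensor_rel] unfolding elt_set_plus_def by force

lemma coset_eq_tensor_relD: "u +o tensor_rel A M N = tensor_rel A M N \<Longrightarrow> u \<in> tensor_rel A M N"
  using coset_self by blast

lemma tensor_rel_add_self: "tensor_rel A M N + tensor_rel A M N = tensor_rel A M N"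
  using frag.subspace_add[OF subspace_tensor_rel] frag.subspace_0[OF subspace_tensor_rel]
  by (force simp: set_plus_def)

lemma coset_add: "(u +o tensor_rel A M N) + (w +o tensor_rel A M N) = (u + w) +o tensor_rel A M N"
  by (simp add: set_plus_rearrange tensor_rel_add_self)

text \<open>Maps on tensors are computed on a chosen representative; what is known of it is that it
  differs from any given one by a relation.\<close>

lemma coset_some:
  obtains r where "r \<in> tensor_rel A M N" "(SOME z. z \<in> u +o tensor_rel A M N) = u + r"
proof -
  have "(SOME z. z \<in> u +o tensor_rel A M N) \<in> u +o tensor_rel A M N"
    by (rule someI[of "\<lambda>z. z \<in> u +o tensor_rel A M N"]) (rule coset_self)
  then show ?thesis using that by (auto simp: elt_set_plus_def)
qed

text \<open>This allows identities valid only on the carriers to be applied term by term to the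
  chosen representative.\<close>

lemma keys_some_tensor:
  assumes "tensor_closed A M N" "X \<in> car (tensor A M N)"
  shows "Poly_Mapping.keys (SOME z. z \<in> X) \<subseteq> car M \<times> car N"
proof -
  obtain u where u: "X = u +o tensor_rel A M N" "Poly_Mapping.keys u \<subseteq> car M \<times> car N"
    using assms(2) by (auto simp: tensor_def)
  obtain r where "r \<in> tensor_rel A M N" "(SOME z. z \<in> X) = u + r"
    using coset_some u(1) by blast
  then show ?thesis
    using keys_tensor_rel[OF assms(1)] u(2) keys_add[of u r] by fastforce
qed

text \<open>The formal version of \<open>g \<otimes> h\<close>: \<open>tensor_map\<close> returns
  the coset of \<open>frag_map g h z\<close> for the chosen representative \<open>z\<close>.\<close>

abbreviation frag_map :: "('k \<Rightarrow> 'm) \<Rightarrow> ('l \<Rightarrow> 'n) \<Rightarrow> ('k \<times> 'l \<Rightarrow>\<^sub>0 int) \<Rightarrow> ('m \<times> 'n \<Rightarrow>\<^sub>0 int)" where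
  "frag_map g h \<equiv> frag_extend (\<lambda>(x, y). frag_of (g x, h y))"

lemma keys_frag_map:
  assumes "Poly_Mapping.keys z \<subseteq> S" "\<And>x y. (x, y) \<in> S \<Longrightarrow> (g x, h y) \<in> T"
  shows "Poly_Mapping.keys (frag_map g h z) \<subseteq> T"
  using keys_frag_extend[of "\<lambda>(x, y). frag_of (g x, h y)" z] assms
  by (fastforce split: prod.splits)

section \<open>Biadditive maps evaluated on formal sums\<close>

definition balanced ::
    "'w set \<Rightarrow> ('w, 'm::plus) bimod \<Rightarrow> ('w, 'n::plus) bimod \<Rightarrow> ('m \<Rightarrow> 'n \<Rightarrow> 'v::plus) \<Rightarrow> bool" where
  "balanced A M N f \<longleftrightarrow>
     (\<forall>x\<in>car M. \<forall>x'\<in>car M. \<forall>y\<in>car N. f (x + x') y = f x y + f x' y) \<and>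
     (\<forall>x\<in>car M. \<forall>y\<in>car N. \<forall>y'\<in>car N. f x (y + y') = f x y + f x y') \<and>
     (\<forall>x\<in>car M. \<forall>a\<in>A. \<forall>y\<in>car N. f (ract M x a) y = f x (lact N a y))"

context star_calculus
begin

sublocale vs: vector_space "smul D"
  by (rule vector_space)

text \<open>The sum behind \<open>tensor_lift\<close>, separated from the choice of representative.
  On formal sums it is additive for every \<open>f\<close>, balanced or not.\<close>

definition lift_rep :: "('m \<Rightarrow> 'n \<Rightarrow> 'w) \<Rightarrow> ('m \<times> 'n \<Rightarrow>\<^sub>0 int) \<Rightarrow> 'w" where
  "lift_rep f z =
     (\<Sum>p\<in>Poly_Mapping.keys z. smul D (of_int (Poly_Mapping.lookup z p)) (f (fst p) (snd p)))"

lemma tensor_lift_eq: "tensor_lift D f X = lift_rep f (SOME z. z \<in> X)"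
  by (simp add: tensor_lift_def lift_rep_def Let_def)

lemma lift_rep_superset:
  assumes "finite S" "Poly_Mapping.keys z \<subseteq> S"
  shows "lift_rep f z = (\<Sum>p\<in>S. smul D (of_int (Poly_Mapping.lookup z p)) (f (fst p) (snd p)))"
  unfolding lift_rep_def using assms
  by (intro sum.mono_neutral_left) (auto simp: in_keys_iff)

lemma lift_rep_0 [simp]: "lift_rep f 0 = 0"
  by (simp add: lift_rep_def)

lemma lift_rep_frag_of [simp]: "lift_rep f (frag_of p) = f (fst p) (snd p)"
  by (simp add: lift_rep_def)

lemma lift_rep_add: "lift_rep f (z + w) = lift_rep f z + lift_rep f w"
proof -
  let ?S = "Poly_Mapping.keys z \<union> Poly_Mapping.keys w"
  have "finite ?S" "Poly_Mapping.keys (z + w) \<subseteq> ?S" by (simp_all add: keys_add)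
  then show ?thesis
    by (simp add: lift_rep_superset[of ?S] lookup_add vs.scale_left_distrib sum.distrib)
qed

lemma lift_rep_diff: "lift_rep f (z - w) = lift_rep f z - lift_rep f w"
  using lift_rep_add[of f "z - w" w] by simp

lemma lift_rep_cmul: "lift_rep f (frag_cmul c z) = smul D (of_int c) (lift_rep f z)"
proof -
  have "Poly_Mapping.keys (frag_cmul c z) \<subseteq> Poly_Mapping.keys z" by (rule keys_cmul)
  then have "lift_rep f (frag_cmul c z) = (\<Sum>p\<in>Poly_Mapping.keys z.
      smul D (of_int (Poly_Mapping.lookup (frag_cmul c z) p)) (f (fst p) (snd p)))"
    by (intro lift_rep_superset) auto
  then show ?thesis by (simp add: lift_rep_def vs.scale_sum_right)
qed

lemma lift_rep_cong:
  assumes "Poly_Mapping.keys z \<subseteq> S \<times> T" "\<And>x y. x \<in> S \<Longrightarrow> y \<in> T \<Longrightarrow> f x y = g x y"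
  shows "lift_rep f z = lift_rep g z"
  unfolding lift_rep_def using assms by (intro sum.cong) auto

lemma lift_rep_frag_map: "lift_rep f (frag_map g h z) = lift_rep (\<lambda>x y. f (g x) (h y)) z"
  using subset_UNIV
  by (induction z rule: frag_induction) (auto simp: frag_extend_diff lift_rep_diff)

lemma lift_rep_fun_add: "lift_rep (\<lambda>x y. f x y + g x y) z = lift_rep f z + lift_rep g z"
  by (simp add: lift_rep_def vs.scale_right_distrib sum.distrib)

lemma lift_rep_smul: "lift_rep (\<lambda>x y. smul D c (f x y)) z = smul D c (lift_rep f z)"
  by (simp add: lift_rep_def vs.scale_sum_right mult.commute)

lemma lift_rep_in_subspace:
  assumes "vs.subspace U" "Poly_Mapping.keys z \<subseteq> S \<times> T" "\<And>x y. x \<in> S \<Longrightarrow> y \<in> T \<Longrightarrow> f x y \<in> U"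
  shows "lift_rep f z \<in> U"
  unfolding lift_rep_def using assms
  by (intro vs.subspace_sum vs.subspace_scale) auto

text \<open>The map \<open>g\<close> is linear only on \<open>U\<close>, as the type projections are
  on one-forms. The induction over the sum therefore also carries membership of the partial sums in
  \<open>U\<close>.\<close>

lemma lift_rep_hom:
  fixes f :: "'m \<Rightarrow> 'n \<Rightarrow> 'w"
  assumes "Poly_Mapping.keys z \<subseteq> S \<times> T" "\<And>x y. x \<in> S \<Longrightarrow> y \<in> T \<Longrightarrow> f x y \<in> U"
    and "vs.subspace U" "\<And>x y. x \<in> U \<Longrightarrow> y \<in> U \<Longrightarrow> g (x + y) = g x + g y"
    and "\<And>c x. x \<in> U \<Longrightarrow> g (smul D c x) = smul D c (g x)"
  shows "g (lift_rep f z) = lift_rep (\<lambda>x y. g (f x y)) z"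
proof -
  have g0: "g 0 = 0"
    using assms(5)[of 0 0] vs.subspace_0[OF assms(3)] by simp
  have "g (\<Sum>p\<in>I. h p) = (\<Sum>p\<in>I. g (h p)) \<and> (\<Sum>p\<in>I. h p) \<in> U"
    if "finite I" "\<And>p. p \<in> I \<Longrightarrow> h p \<in> U" for I and h :: "'m \<times> 'n \<Rightarrow> 'w"
    using that
    by (induction I rule: finite_induct)
       (auto simp: g0 assms(4) vs.subspace_0[OF assms(3)] vs.subspace_add[OF assms(3)])
  moreover have "f (fst p) (snd p) \<in> U" if "p \<in> Poly_Mapping.keys z" for p
    using that assms(1,2) by auto
  ultimately show ?thesis
    unfolding lift_rep_def using assms(5) vs.subspace_scale[OF assms(3)] by (simp cong: sum.cong)
qed

text \<open>The three clauses of \<open>balanced\<close> say that the three families of generators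
  go to zero; additivity extends this to their span.\<close>

lemma lift_rep_tensor_rel:
  assumes "balanced A M N f" "r \<in> tensor_rel A M N"
  shows "lift_rep f r = 0"
  using assms(2) unfolding tensor_rel_def
proof (induction rule: frag.span_induct)
  case base
  show ?case by (auto simp: frag.subspace_def lift_rep_add lift_rep_cmul)
next
  case (step x)
  then show ?case
    using assms(1) by (auto simp: lift_rep_diff balanced_def)
qed

lemma tensor_lift_coset:
  assumes "balanced A M N f"
  shows "tensor_lift D f (u +o tensor_rel A M N) = lift_rep f u"
proof -
  obtain r where "r \<in> tensor_rel A M N" "(SOME z. z \<in> u +o tensor_rel A M N) = u + r"
    by (rule coset_some)
  then show ?thesis
    by (simp add: tensor_lift_eq lift_rep_add lift_rep_tensor_rel[OF assms])
qed

section \<open>Scalars, degree zero and vector fields\<close>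

lemma smul_as_mult: "smul D c x = smul D c 1 * x" "smul D c x = x * smul D c 1"
  by (metis smul_mult_left mult_1_left, metis smul_mult_right mult_1_right)

lemma smul_one_forms: "smul D c 1 \<in> forms D 0"
  by (rule vs.subspace_scale[OF subspace_forms one_forms])

lemma forms_mult_0 [intro]:
  "a \<in> forms D 0 \<Longrightarrow> x \<in> forms D n \<Longrightarrow> a * x \<in> forms D n"
  "a \<in> forms D 0 \<Longrightarrow> x \<in> forms D n \<Longrightarrow> x * a \<in> forms D n"
  using mult_forms[of a 0 x n] mult_forms[of x n a 0] by simp_all

lemma dif_smul: "dif D (smul D c x) = smul D c (dif D x)"
  using dif_linear by (simp add: Vector_Spaces.linear_iff)

text \<open>The Leibniz rule for \<open>1 * 1\<close> reads d1 = d1 + d1.\<close>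

lemma dif_one: "dif D 1 = 0"
  using leibniz[OF one_forms, of 1] by simp

lemma Vec_iff:
  "v \<in> car (Vec D) \<longleftrightarrow>
     (\<forall>\<xi>\<in>forms D 1. v \<xi> \<in> forms D 0) \<and>
     (\<forall>\<xi>\<in>forms D 1. \<forall>\<eta>\<in>forms D 1. v (\<xi> + \<eta>) = v \<xi> + v \<eta>) \<and>
     (\<forall>\<xi>\<in>forms D 1. \<forall>a\<in>forms D 0. v (\<xi> * a) = v \<xi> * a) \<and> (\<forall>\<xi>. \<xi> \<notin> forms D 1 \<longrightarrow> v \<xi> = 0)"
  by (simp add: Vec_def right_map_def additive_map_def Omega_def)

text \<open>A complex scalar acts as multiplication by the central element \<open>smul D c 1\<close>
  of A, so A-linearity on one side includes complex linearity.\<close>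

lemma Vec_smul:
  assumes "v \<in> car (Vec D)" "\<xi> \<in> forms D 1"
  shows "v (smul D c \<xi>) = smul D c (v \<xi>)"
  using assms smul_one_forms by (metis Vec_iff smul_as_mult(2))

lemma ev_tens:
  assumes "v \<in> car (Vec D)" "\<xi> \<in> forms D 1"
  shows "ev D (tens (forms D 0) (Vec D) (Omega D 1) v \<xi>) = v \<xi>"
proof -
  have "balanced (forms D 0) (Vec D) (Omega D 1) (\<lambda>v \<xi>. v \<xi>)"
    unfolding balanced_def by (auto simp: Vec_iff) (auto simp: Vec_def Omega_def)
  then show ?thesis
    by (simp add: ev_def tens_def tensor_lift_coset)
qed

text \<open>Associativity and distributivity hold in the whole algebra, so \<open>S\<close> and
  \<open>T\<close> may be arbitrary, for instance forms of a fixed type.\<close>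

lemma balanced_mult: "balanced (forms D 0) \<lparr>car = S, lact = (*), ract = (*)\<rparr>
    \<lparr>car = T, lact = (*), ract = (*)\<rparr> (*)"
  by (simp add: balanced_def algebra_simps)

lemma tensor_closed_Omega: "tensor_closed (forms D 0) (Omega D m) (Omega D n)"
  unfolding tensor_closed_def Omega_def
  using vs.subspace_add[OF subspace_forms] by auto

lemma tensor_closed_Omega_Vec: "tensor_closed (forms D 0) (Omega D m) (Vec D)"
proof -
  have "v + w \<in> car (Vec D)" if "v \<in> car (Vec D)" "w \<in> car (Vec D)" for v w
    using that vs.subspace_add[OF subspace_forms] by (auto simp: Vec_iff algebra_simps)
  moreover have "lact (Vec D) a v \<in> car (Vec D)" if "v \<in> car (Vec D)" "a \<in> forms D 0" for a v
    using that by (auto simp: Vec_iff algebra_simps) (auto simp: Vec_def algebra_simps Vec_iff)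
  ultimately show ?thesis
    unfolding tensor_closed_def Omega_def
    using vs.subspace_add[OF subspace_forms] by auto
qed

end

section \<open>Eigenspaces of the almost complex structure on forms\<close>

locale almost_complex_calculus = star_calculus D for D :: "('w::{ring,monoid_mult}) dga" +
  fixes J :: "'w \<Rightarrow> 'w"
  assumes almost_complex: "almost_complex D J"
begin

lemma J_mem [intro]: "\<xi> \<in> forms D 1 \<Longrightarrow> J \<xi> \<in> forms D 1"
  and J_add: "\<xi> \<in> forms D 1 \<Longrightarrow> \<eta> \<in> forms D 1 \<Longrightarrow> J (\<xi> + \<eta>) = J \<xi> + J \<eta>"
  and J_right: "\<xi> \<in> forms D 1 \<Longrightarrow> a \<in> forms D 0 \<Longrightarrow> J (\<xi> * a) = J \<xi> * a"
  and J_left: "\<xi> \<in> forms D 1 \<Longrightarrow> a \<in> forms D 0 \<Longrightarrow> J (a * \<xi>) = a * J \<xi>"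
  and J_J: "\<xi> \<in> forms D 1 \<Longrightarrow> J (J \<xi>) = - \<xi>"
  using almost_complex
  by (simp_all add: almost_complex_def bimod_map_def right_map_def additive_map_def Omega_def)

lemma J_smul: "\<xi> \<in> forms D 1 \<Longrightarrow> J (smul D c \<xi>) = smul D c (J \<xi>)"
  by (metis J_left smul_as_mult(1) smul_one_forms)

lemma descends_to_J_forms: "descends_to D J n (J_forms D J n)"
  using almost_complex unfolding J_forms_def almost_complex_def by (metis someI_ex)

lemma J_forms_add:
  assumes "x \<in> forms D n" "y \<in> forms D n"
  shows "J_forms D J n (x + y) = J_forms D J n x + J_forms D J n y"
  using descends_to_J_forms[of n] assms by (simp add: descends_to_def additive_map_def Omega_def)

lemma J_forms_prod_list:
  assumes "a \<in> forms D 0" "set xs \<subseteq> forms D 1" "length xs = n"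
  shows "J_forms D J n (a * prod_list xs) = a * (\<Sum>i<n. prod_list (xs[i := J (xs ! i)]))"
  using descends_to_J_forms[of n] assms unfolding descends_to_def by blast

lemma J_forms_1: "\<xi> \<in> forms D 1 \<Longrightarrow> J_forms D J 1 \<xi> = J \<xi>"
  using J_forms_prod_list[OF one_forms, of "[\<xi>]" 1] by simp

lemma J_forms_2:
  "\<xi> \<in> forms D 1 \<Longrightarrow> \<eta> \<in> forms D 1 \<Longrightarrow> J_forms D J 2 (\<xi> * \<eta>) = J \<xi> * \<eta> + \<xi> * J \<eta>"
  using J_forms_prod_list[OF one_forms, of "[\<xi>, \<eta>]" 2]
  by (simp add: numeral_2_eq_2)

text \<open>\<open>descends_to\<close> grants only additivity. On a generator the scalar is absorbed
  into the coefficient \<open>a\<close>, and additivity carries this to the span.\<close>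

lemma J_forms_smul:
  assumes "x \<in> forms D n"
  shows "J_forms D J n (smul D c x) = smul D c (J_forms D J n x)"
proof -
  let ?K = "J_forms D J n"
  let ?G = "{a * prod_list xs |a xs. a \<in> forms D 0 \<and> set xs \<subseteq> forms D 1 \<and> length xs = n}"
  have G: "g \<in> forms D n" "?K (smul D d g) = smul D d (?K g)" if gG: "g \<in> ?G" for g d
  proof -
    show "g \<in> forms D n" using gG by (subst generated) (rule vs.span_base)
    obtain a xs where g: "g = a * prod_list xs" "a \<in> forms D 0" "set xs \<subseteq> forms D 1" "length xs = n"
      using gG by blast
    have "?K (smul D d a * prod_list xs) = smul D d (?K (a * prod_list xs))"
      using g J_forms_prod_list vs.subspace_scale[OF subspace_forms g(2)]
      by (simp add: smul_mult_left)
    then show "?K (smul D d g) = smul D d (?K g)" by (simp add: g smul_mult_left)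
  qed
  have K0: "?K 0 = 0"
    using J_forms_add[of 0 n 0] vs.subspace_0[OF subspace_forms] by simp
  have "x \<in> vs.span ?G" using assms by (subst (asm) generated)
  then have "x \<in> forms D n \<and> ?K (smul D c x) = smul D c (?K x)"
  proof (induction rule: vs.span_induct_alt)
    case base
    show ?case using K0 vs.subspace_0[OF subspace_forms] by simp
  next
    case (step d g y)
    have dg: "smul D d g \<in> forms D n" "smul D c (smul D d g) \<in> forms D n" "smul D c y \<in> forms D n"
      using step G(1)[of g] vs.subspace_scale[OF subspace_forms] by auto
    have "?K (smul D c (smul D d g + y)) = ?K (smul D c (smul D d g)) + ?K (smul D c y)"
      using dg J_forms_add by (simp add: vs.scale_right_distrib)
    also have "\<dots> = smul D c (?K (smul D d g)) + smul D c (?K y)"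
      using G(2)[OF step(1)] step(2) by simp
    also have "\<dots> = smul D c (?K (smul D d g + y))"
      using step dg J_forms_add by (simp add: vs.scale_right_distrib)
    finally show ?case using step dg vs.subspace_add[OF subspace_forms] by simp
  qed
  then show ?thesis by simp
qed

lemma J_forms_sum:
  assumes "finite I" "\<And>i. i \<in> I \<Longrightarrow> u i \<in> forms D n"
  shows "J_forms D J n (\<Sum>i\<in>I. u i) = (\<Sum>i\<in>I. J_forms D J n (u i))"
  using assms
proof (induction I rule: finite_induct)
  case empty
  show ?case using J_forms_smul[OF vs.subspace_0[OF subspace_forms], of n 0] by simp
next
  case (insert i I)
  then show ?case
    using vs.subspace_sum[OF subspace_forms, of I u n] by (simp add: J_forms_add)
qed

text \<open>Independence of eigenvectors: applying \<open>J - l s\<close> to the sum removes the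
  term at \<open>s\<close> and scales the others by the nonzero \<open>l i - l s\<close>, which
  reduces to the smaller index set.\<close>

lemma eigenvectors_sum_zero:
  assumes "finite I" "inj_on l I" "\<And>i. i \<in> I \<Longrightarrow> u i \<in> forms D n"
    and "\<And>i. i \<in> I \<Longrightarrow> J_forms D J n (u i) = smul D (l i) (u i)" and "(\<Sum>i\<in>I. u i) = 0"
  shows "\<forall>i\<in>I. u i = 0"
  using assms
proof (induction I arbitrary: u rule: finite_induct)
  case empty
  show ?case by simp
next
  case (insert s I)
  let ?w = "\<lambda>i. smul D (l i - l s) (u i)"
  have "(\<Sum>i\<in>insert s I. ?w i) =
      J_forms D J n (\<Sum>i\<in>insert s I. u i) - smul D (l s) (\<Sum>i\<in>insert s I. u i)"
    using insert.prems(2,3) insert.hyps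
    by (subst J_forms_sum)
       (auto simp: vs.scale_sum_right vs.scale_left_diff_distrib sum_subtractf
         vs.scale_right_distrib cong: sum.cong)
  also have "\<dots> = 0"
    using J_forms_smul[OF vs.subspace_0[OF subspace_forms], of n 0] insert.prems(4) by simp
  finally have "(\<Sum>i\<in>I. ?w i) = 0" using insert.hyps by simp
  moreover have "?w i \<in> forms D n" "J_forms D J n (?w i) = smul D (l i) (?w i)" if "i \<in> I" for i
    using that insert.prems(2,3) vs.subspace_scale[OF subspace_forms]
    by (auto simp: J_forms_smul vs.scale_left_commute)
  ultimately have w: "\<forall>i\<in>I. ?w i = 0"
    using insert.IH[of ?w] insert.prems(1) by auto
  have *: "u i = 0" if "i \<in> I" for i
  proof -
    have "l i \<noteq> l s" using that insert.prems(1) insert.hyps(2) by (auto simp: inj_on_def)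
    then show ?thesis using w that by auto
  qed
  then show ?case using insert.prems(4) insert.hyps by simp
qed

lemma subspace_forms_pq: "vs.subspace (forms_pq D J p q)"
  unfolding vs.subspace_def forms_pq_def
  using J_forms_add J_forms_smul vs.subspace_add[OF subspace_forms] vs.subspace_0[OF subspace_forms]
    vs.subspace_scale[OF subspace_forms] J_forms_smul[OF vs.subspace_0[OF subspace_forms], of _ 0]
  by (auto simp: vs.scale_right_distrib vs.scale_left_commute)

text \<open>The definite description in \<open>proj_pq\<close> needs a unique decomposition. The
  difference of two is a vanishing sum of eigenvectors with distinct eigenvalues; existence is
  supplied by \<open>f\<close>.\<close>

lemma proj_pq_eqI:
  assumes "\<And>r. r \<le> p + q \<Longrightarrow> f r \<in> forms_pq D J r (p + q - r)" and "x = (\<Sum>r\<le>p + q. f r)"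
  shows "proj_pq D J p q x = f p"
proof -
  \<comment> \<open>Truncation, because the described family has to be zero beyond
    \<open>p + q\<close>.\<close>
  let ?f = "\<lambda>r. if r \<le> p + q then f r else 0"
  let ?P = "\<lambda>g. (\<forall>r\<le>p + q. g r \<in> forms_pq D J r (p + q - r)) \<and> (\<forall>r>p + q. g r = 0) \<and>
             x = (\<Sum>r\<le>p + q. g r)"
  have uniq: "g = ?f" if g: "?P g" for g
  proof -
    let ?l = "\<lambda>r. \<i> * (of_nat r - of_nat (p + q - r))"
    have "\<forall>r\<in>{..p + q}. g r - f r = 0"
    proof (rule eigenvectors_sum_zero[where l = ?l and n = "p + q"])
      \<comment> \<open>For \<open>r \<le> p + q\<close> the natural subtraction is exact, so the
        eigenvalue is \<i> times 2r - (p + q).\<close>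
      show "inj_on ?l {..p + q}" by (auto simp: inj_on_def of_nat_diff)
      fix r assume r: "r \<in> {..p + q}"
      then have "g r - f r \<in> forms_pq D J r (p + q - r)"
        using g assms(1) by (intro vs.subspace_diff[OF subspace_forms_pq]) auto
      then show "g r - f r \<in> forms D (p + q)"
        "J_forms D J (p + q) (g r - f r) = smul D (?l r) (g r - f r)"
        using r by (auto simp: forms_pq_def)
    next
      show "(\<Sum>r\<le>p + q. g r - f r) = 0" using g assms(2) by (simp add: sum_subtractf)
    qed simp
    then show ?thesis using g by (auto simp: fun_eq_iff)
  qed
  have "(THE g. ?P g) = ?f"
  proof (rule the_equality)
    show "?P ?f" using assms by auto
  qed (rule uniq)
  then show ?thesis unfolding proj_pq_def by simp
qed

section \<open>Type decomposition in degrees one and two\<close>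

text \<open>
  For \<open>c\<^sup>2 = -1\<close> this is the projection of \<open>\<Omega>\<^sup>1A\<close> onto the \<open>c\<close>-eigenspace of \<open>J\<close>, so \<open>c = \<i>\<close> gives
  \<open>\<pi>\<^sup>1\<^sup>,\<^sup>0\<close> and \<open>c = -\<i>\<close> gives \<open>\<pi>\<^sup>0\<^sup>,\<^sup>1\<close>.
\<close>

definition eigen_part :: "complex \<Rightarrow> 'w \<Rightarrow> 'w" where
  "eigen_part c \<xi> = smul D (1/2) (\<xi> - smul D c (J \<xi>))"

lemma eigen_part_mem [intro]: "\<xi> \<in> forms D 1 \<Longrightarrow> eigen_part c \<xi> \<in> forms D 1"
  unfolding eigen_part_def
  by (intro vs.subspace_scale vs.subspace_diff subspace_forms J_mem)

lemma eigen_part_sum: "eigen_part \<i> \<xi> + eigen_part (- \<i>) \<xi> = \<xi>"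
proof -
  have "eigen_part \<i> \<xi> + eigen_part (- \<i>) \<xi> = smul D (1/2) \<xi> + smul D (1/2) \<xi>"
    by (simp add: eigen_part_def algebra_simps vs.scale_right_diff_distrib vs.scale_right_distrib)
  also have "\<dots> = smul D (1/2 + 1/2) \<xi>" by (simp only: vs.scale_left_distrib)
  finally show ?thesis by simp
qed

lemma eigen_part_add:
  "\<xi> \<in> forms D 1 \<Longrightarrow> \<eta> \<in> forms D 1 \<Longrightarrow> eigen_part c (\<xi> + \<eta>) = eigen_part c \<xi> + eigen_part c \<eta>"
  by (simp add: eigen_part_def J_add algebra_simps vs.scale_right_diff_distrib vs.scale_right_distrib)

lemma eigen_part_right:
  "\<xi> \<in> forms D 1 \<Longrightarrow> a \<in> forms D 0 \<Longrightarrow> eigen_part c (\<xi> * a) = eigen_part c \<xi> * a"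
  by (simp add: eigen_part_def J_right algebra_simps flip: smul_mult_left)

lemma eigen_part_left:
  "\<xi> \<in> forms D 1 \<Longrightarrow> a \<in> forms D 0 \<Longrightarrow> eigen_part c (a * \<xi>) = a * eigen_part c \<xi>"
  by (simp add: eigen_part_def J_left algebra_simps flip: smul_mult_right)

lemma eigen_part_smul: "\<xi> \<in> forms D 1 \<Longrightarrow> eigen_part c (smul D d \<xi>) = smul D d (eigen_part c \<xi>)"
  by (metis eigen_part_left smul_as_mult(1) smul_one_forms)

text \<open>From J J = -1 and c c = -1, both sides are half of
  \<open>J \<xi> + smul D c \<xi>\<close>.\<close>

lemma J_eigen_part:
  assumes "\<xi> \<in> forms D 1" "c * c = -1"
  shows "J (eigen_part c \<xi>) = smul D c (eigen_part c \<xi>)"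
proof -
  have "J (\<xi> + smul D (- c) (J \<xi>)) = J \<xi> + smul D (- c) (- \<xi>)"
    using assms vs.subspace_scale[OF subspace_forms, of "J \<xi>" 1 "- c"]
    by (simp only: J_add J_smul J_J J_mem)
  then have "J (eigen_part c \<xi>) = smul D (1/2) (J \<xi> + smul D c \<xi>)"
    using J_smul[of "\<xi> - smul D c (J \<xi>)" "1/2"] vs.subspace_diff[OF subspace_forms assms(1)]
      vs.subspace_scale[OF subspace_forms J_mem[OF assms(1)]]
    by (simp add: eigen_part_def del: One_nat_def)
  moreover have "smul D c (\<xi> - smul D c (J \<xi>)) = J \<xi> + smul D c \<xi>"
    by (simp add: vs.scale_right_diff_distrib assms(2))
  ultimately show ?thesis
    unfolding eigen_part_def by (metis vs.scale_left_commute)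
qed

lemma forms_10_iff: "\<xi> \<in> forms_pq D J 1 0 \<longleftrightarrow> \<xi> \<in> forms D 1 \<and> J \<xi> = smul D \<i> \<xi>"
  using J_forms_1 by (auto simp: forms_pq_def)

lemma forms_01_iff: "\<xi> \<in> forms_pq D J 0 1 \<longleftrightarrow> \<xi> \<in> forms D 1 \<and> J \<xi> = smul D (- \<i>) \<xi>"
  using J_forms_1 by (auto simp: forms_pq_def)

lemma eigen_part_10: "\<xi> \<in> forms D 1 \<Longrightarrow> eigen_part \<i> \<xi> \<in> forms_pq D J 1 0"
  using J_eigen_part[of \<xi> \<i>] eigen_part_mem[of \<xi> \<i>] unfolding forms_10_iff by simp

lemma eigen_part_01: "\<xi> \<in> forms D 1 \<Longrightarrow> eigen_part (- \<i>) \<xi> \<in> forms_pq D J 0 1"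
  using J_eigen_part[of \<xi> "- \<i>"] eigen_part_mem[of \<xi> "- \<i>"] unfolding forms_01_iff by simp

text \<open>The index \<open>r\<close> of the decomposition is the first degree of the type, so the
  (0,1) component sits at \<open>r = 0\<close>.\<close>

lemma proj_01:
  assumes "\<xi> \<in> forms D 1"
  shows "proj_pq D J 0 1 \<xi> = eigen_part (- \<i>) \<xi>"
proof -
  let ?f = "\<lambda>r::nat. if r = 0 then eigen_part (- \<i>) \<xi> else eigen_part \<i> \<xi>"
  have "proj_pq D J 0 1 \<xi> = ?f 0"
  proof (rule proj_pq_eqI[where f = ?f])
    show "?f r \<in> forms_pq D J r (0 + 1 - r)" if "r \<le> 0 + 1" for r
      using that eigen_part_10[OF assms] eigen_part_01[OF assms] by (cases r) auto
    show "\<xi> = (\<Sum>r\<le>0 + 1. ?f r)"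
      using eigen_part_sum[of \<xi>] by (simp add: add.commute)
  qed
  then show ?thesis by simp
qed

text \<open>\<open>J\<close> acts on products as a derivation, so eigenvalues add: \<i> + \<i> =
  2\<i>.\<close>

lemma mult_10_10:
  assumes "\<xi> \<in> forms_pq D J 1 0" "\<eta> \<in> forms_pq D J 1 0"
  shows "\<xi> * \<eta> \<in> forms_pq D J 2 0"
proof -
  have "smul D \<i> (\<xi> * \<eta>) + smul D \<i> (\<xi> * \<eta>) = smul D (\<i> * 2) (\<xi> * \<eta>)"
    by (simp flip: vs.scale_left_distrib)
  then show ?thesis
    using assms J_forms_2[of \<xi> \<eta>] mult_forms[of \<xi> 1 \<eta> 1] unfolding forms_10_iff
    by (simp add: forms_pq_def numeral_2_eq_2 flip: smul_mult_left smul_mult_right)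
qed

text \<open>Here the eigenvalues \<i> and -\<i> cancel, and type (1,1) is the kernel of
  \<open>J\<close> in degree two.\<close>

lemma mult_10_01:
  assumes "\<xi> \<in> forms_pq D J 1 0" "\<eta> \<in> forms_pq D J 0 1"
  shows "\<xi> * \<eta> \<in> forms_pq D J 1 1"
  using assms J_forms_2[of \<xi> \<eta>] mult_forms[of \<xi> 1 \<eta> 1] unfolding forms_10_iff forms_01_iff
  by (simp add: forms_pq_def numeral_2_eq_2 flip: smul_mult_left smul_mult_right)

lemma proj_11:
  assumes "x \<in> forms_pq D J 1 1" "y \<in> forms_pq D J 2 0"
  shows "proj_pq D J 1 1 (x + y) = x"
proof -
  let ?f = "\<lambda>r::nat. if r = 0 then 0 else if r = 1 then x else y"
  have "proj_pq D J 1 1 (x + y) = ?f 1"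
  proof (rule proj_pq_eqI[where f = ?f])
    show "?f r \<in> forms_pq D J r (1 + 1 - r)" if "r \<le> 1 + 1" for r
    proof -
      have "r = 0 \<or> r = 1 \<or> r = 2" using that by auto
      then show ?thesis using assms vs.subspace_0[OF subspace_forms_pq] by auto
    qed
    show "x + y = (\<Sum>r\<le>1 + 1. ?f r)" by simp
  qed
  then show ?thesis by simp
qed

text \<open>A field of type (1,0) kills (0,1)-forms: for such \<open>\<eta>\<close>, the value
  \<open>v (J \<eta>)\<close> is both \<i> and -\<i> times \<open>v \<eta>\<close>.\<close>

lemma Vec10_eigen_part:
  assumes "v \<in> Vec10 D J" "\<xi> \<in> forms D 1"
  shows "v (eigen_part \<i> \<xi>) = v \<xi>"
proof -
  have v: "v \<in> car (Vec D)" using assms(1) by (simp add: Vec10_def)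
  have "J_Vec D J v \<eta> = smul D \<i> (v \<eta>)" for \<eta>
    using assms(1) by (simp add: Vec10_def)
  from this[of "eigen_part (- \<i>) \<xi>"]
  have "smul D (- \<i>) (v (eigen_part (- \<i>) \<xi>)) = smul D \<i> (v (eigen_part (- \<i>) \<xi>))"
    using assms(2) J_eigen_part[of \<xi> "- \<i>"] eigen_part_mem[of \<xi> "- \<i>"] Vec_smul[OF v, of "eigen_part (- \<i>) \<xi>" "- \<i>"]
    by (simp add: J_Vec_def)
  then have "v (eigen_part (- \<i>) \<xi>) = 0" by (subst (asm) vs.scale_cancel_right) (simp add: complex_eq_iff)
  moreover have "v \<xi> = v (eigen_part \<i> \<xi>) + v (eigen_part (- \<i>) \<xi>)"
    using v assms(2) eigen_part_mem eigen_part_sum[of \<xi>] by (metis Vec_iff)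
  ultimately show ?thesis by simp
qed

end

section \<open>Holomorphy of the evaluation on an exact form\<close>

theorem corollary11p2:
  fixes D :: "('w::{ring,monoid_mult}) dga"
    and J :: "'w \<Rightarrow> 'w"
    and nab :: "'w \<Rightarrow> ('w, 'w) tensor"
    and sig :: "('w, 'w) tensor \<Rightarrow> ('w, 'w) tensor"
    and nabV :: "('w \<Rightarrow> 'w) \<Rightarrow> ('w, 'w \<Rightarrow> 'w) tensor"
    and v :: "'w \<Rightarrow> 'w"
  assumes calculus: "star_calculus D"
    and J: "almost_complex D J"
    and nab: "right_bimod_cov_deriv D nab sig"
    and nabV: "dual_cov_deriv D nab nabV"
    and a: "bimod_iso (forms D 0)
              (tensor (forms D 0) (Omega_pq D J 1 0) (Omega_pq D J 0 1)) (Omega_pq D J 1 1)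
              (wedge D)"
    and b: "\<forall>\<xi>\<in>forms D 1.
              tensor_map (forms D 0) (Omega D 1) (Omega D 1) J id (nab \<xi>) = nab (J \<xi>)"
    and c: "\<forall>\<xi>\<in>forms D 1. proj_pq D J 1 1 (torsion_R D nab \<xi>) = 0"
    and v: "v \<in> Vec10 D J"
    and nabv: "tensor_map (forms D 0) (Omega_pq D J 0 1) (Vec D) (proj_pq D J 0 1) id (nabV v) =
               tensor_zero (forms D 0) (Omega_pq D J 0 1) (Vec D)"
  shows "\<forall>a. holomorphic D J a \<longrightarrow>
           holomorphic D J (ev D (tens (forms D 0) (Vec D) (Omega D 1) v (dif D a)))"
proof (intro allI impI)
  note One_nat_def [simp del]
  fix a0 assume hol: "holomorphic D J a0"
  interpret almost_complex_calculus D J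
    using calculus J by (simp add: almost_complex_calculus_def almost_complex_calculus_axioms_def)
  let ?A = "forms D 0" and ?W = "Omega D 1" and ?P = "eigen_part \<i>" and ?Q = "eigen_part (- \<i>)"
  define \<xi> where "\<xi> = dif D a0"
  \<comment> \<open>\<open>z\<close> and \<open>w\<close> are the very representatives selected
    inside \<open>tensor_map\<close> and \<open>tensor_lift\<close>, so the hypotheses unfold to
    statements about them.\<close>
  define z where "z = (SOME z. z \<in> nab \<xi>)"
  define w where "w = (SOME z. z \<in> nabV v)"
  have \<xi>: "\<xi> \<in> forms D 1"
    using hol dif_forms[of a0 0] by (simp add: holomorphic_def \<xi>_def One_nat_def)
  have vV: "v \<in> car (Vec D)" using v by (simp add: Vec10_def)
  have v\<xi>: "v \<xi> \<in> ?A" "dif D (v \<xi>) \<in> forms D 1"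
    using vV \<xi> dif_forms[of "v \<xi>" 0] by (simp_all add: Vec_iff One_nat_def)

  have "?Q \<xi> = 0" using hol proj_01[OF \<xi>] by (simp add: holomorphic_def dbar_def \<xi>_def)
  then have J\<xi>: "J \<xi> = smul D \<i> \<xi>"
    using eigen_part_sum[of \<xi>] J_eigen_part[OF \<xi>, of \<i>] by simp

  have nab_car: "nab \<xi> \<in> car (tensor ?A ?W ?W)"
    and nab_right: "\<And>a. a \<in> ?A \<Longrightarrow> nab (\<xi> * a) = ract (tensor ?A ?W ?W) (nab \<xi>) a + tens ?A ?W ?W \<xi> (dif D a)"
    using nab \<xi> by (simp_all add: right_bimod_cov_deriv_def Let_def additive_map_def Omega_def)
  have nabV_car: "nabV v \<in> car (tensor ?A ?W (Vec D))"
    using nabV vV by (simp add: dual_cov_deriv_def left_cov_deriv_Vec_def Let_def additive_map_def)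
  have keys_z: "Poly_Mapping.keys z \<subseteq> forms D 1 \<times> forms D 1"
    using keys_some_tensor[OF tensor_closed_Omega nab_car] by (simp add: z_def Omega_def)
  have keys_w: "Poly_Mapping.keys w \<subseteq> forms D 1 \<times> car (Vec D)"
    using keys_some_tensor[OF tensor_closed_Omega_Vec nabV_car] by (simp add: w_def Omega_def)

  have bal: "balanced ?A ?W ?W (*)" by (simp add: Omega_def balanced_mult)
  have bal': "balanced ?A (Omega_pq D J 1 0) (Omega_pq D J 0 1) (*)"
    by (simp add: Omega_pq_def balanced_mult)

  txt \<open>
    Hypothesis b turns \<open>J \<xi> = \<i> \<xi>\<close> into \<open>(J \<otimes> id)\<nabla>\<xi> = \<nabla>(\<xi> \<i>) = (\<nabla>\<xi>)\<i>\<close>, as \<open>d\<close> vanishes on scalars.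
  \<close>
  have "tensor_map ?A ?W ?W J id (nab \<xi>) = nab (\<xi> * smul D \<i> 1)"
    using b \<xi> J\<xi> smul_as_mult(2)[of \<i> \<xi>] by simp
  also have "\<dots> = tensor_map ?A ?W ?W id (\<lambda>y. y * smul D \<i> 1) (nab \<xi>) + tens ?A ?W ?W \<xi> 0"
    using nab_right[OF smul_one_forms, of \<i>] by (simp add: tensor_def Omega_def dif_smul dif_one)
  finally have "frag_map J id z +o tensor_rel ?A ?W ?W =
      (frag_map id (\<lambda>y. y * smul D \<i> 1) z + frag_of (\<xi>, 0)) +o tensor_rel ?A ?W ?W"
    unfolding tensor_map_def tens_def coset_add z_def .
  \<comment> \<open>Multiplication is balanced, so it may be applied to both cosets. The Leibniz
    remainder, the formal generator at \<open>(\<xi>, 0)\<close>, contributes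
    \<open>\<xi> * 0 = 0\<close>.\<close>
  then have "lift_rep (*) (frag_map J id z) =
      lift_rep (*) (frag_map id (\<lambda>y. y * smul D \<i> 1) z + frag_of (\<xi>, 0))"
    using tensor_lift_coset[OF bal] by metis
  then have Jz: "lift_rep (\<lambda>x y. J x * y) z = smul D \<i> (lift_rep (*) z)"
    by (simp add: lift_rep_add lift_rep_frag_map flip: lift_rep_smul smul_mult_right)
  \<comment> \<open>\<open>?P\<close> is (1 - \<i> J)/2. By \<open>Jz\<close>, \<open>J\<close> on
    the left factor amounts to \<i>, and -\<i> times \<i> is 1, so \<open>?P\<close> leaves the
    product unchanged.\<close>
  have "lift_rep (\<lambda>x y. ?P x * y) z = lift_rep (\<lambda>x y. smul D (1/2) (x * y + smul D (- \<i>) (J x * y))) z"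
    by (simp add: eigen_part_def algebra_simps flip: smul_mult_left)
  also have "\<dots> = smul D (1/2) (lift_rep (*) z + lift_rep (*) z)"
    by (simp only: lift_rep_smul lift_rep_fun_add Jz) simp
  also have "\<dots> = smul D (1/2 + 1/2) (lift_rep (*) z)"
    by (simp only: vs.scale_left_distrib vs.scale_right_distrib)
  finally have "wedge D (nab \<xi>) = lift_rep (\<lambda>x y. ?P x * (?Q y + ?P y)) z"
    by (simp add: wedge_def tensor_lift_eq z_def eigen_part_sum add.commute)
  \<comment> \<open>The exterior derivative drops out of the torsion because \<open>\<xi>\<close> is
    exact.\<close>
  then have "torsion_R D nab \<xi> = lift_rep (\<lambda>x y. ?P x * ?Q y) z + lift_rep (\<lambda>x y. ?P x * ?P y) z"
    by (simp add: torsion_R_def \<xi>_def dif_dif distrib_left lift_rep_fun_add)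
  moreover have "lift_rep (\<lambda>x y. ?P x * ?Q y) z \<in> forms_pq D J 1 1"
    using keys_z mult_10_01 eigen_part_10 eigen_part_01
    by (intro lift_rep_in_subspace[OF subspace_forms_pq]) auto
  moreover have "lift_rep (\<lambda>x y. ?P x * ?P y) z \<in> forms_pq D J 2 0"
    using keys_z mult_10_10 eigen_part_10
    by (intro lift_rep_in_subspace[OF subspace_forms_pq]) auto
  ultimately have PQ: "lift_rep (\<lambda>x y. ?P x * ?Q y) z = 0"
    using c \<xi> proj_11 by metis

  \<comment> \<open>Injectivity of the product is available only on the tensor product of the two
    typed submodules, so the (1,0) and (0,1) parts of \<open>z\<close> are viewed there, with its
    own relations.\<close>
  let ?R = "tensor_rel ?A (Omega_pq D J 1 0) (Omega_pq D J 0 1)"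
  have "frag_map ?P ?Q z +o ?R = 0 +o ?R"
  proof (rule inj_onD)
    show "inj_on (wedge D) (car (tensor ?A (Omega_pq D J 1 0) (Omega_pq D J 0 1)))"
      using a by (simp add: bimod_iso_def bij_betw_def)
    show "wedge D (frag_map ?P ?Q z +o ?R) = wedge D (0 +o ?R)"
      unfolding wedge_def tensor_lift_coset[OF bal'] by (simp add: lift_rep_frag_map PQ)
    have "Poly_Mapping.keys (frag_map ?P ?Q z) \<subseteq> forms_pq D J 1 0 \<times> forms_pq D J 0 1"
      using eigen_part_10 eigen_part_01 by (intro keys_frag_map[OF keys_z]) auto
    then show "frag_map ?P ?Q z +o ?R \<in> car (tensor ?A (Omega_pq D J 1 0) (Omega_pq D J 0 1))"
      by (auto simp: tensor_def Omega_pq_def)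
    show "0 +o ?R \<in> car (tensor ?A (Omega_pq D J 1 0) (Omega_pq D J 0 1))"
      unfolding tensor_def by (simp del: set_zero_plus) (metis empty_subsetI keys_zero)
  qed
  then have "frag_map ?P ?Q z \<in> ?R" by (simp add: coset_eq_tensor_relD)
  \<comment> \<open>A formal sum of relations is killed by every balanced map; evaluating
    \<open>v\<close> on the left factor is one, by right linearity of \<open>v\<close>.\<close>
  moreover have "balanced ?A (Omega_pq D J 1 0) (Omega_pq D J 0 1) (\<lambda>x y. v x * y)"
    using vV by (simp add: balanced_def Omega_pq_def forms_10_iff Vec_iff algebra_simps)
  ultimately have "lift_rep (\<lambda>x y. v (?P x) * ?Q y) z = 0"
    using lift_rep_tensor_rel by (fastforce simp: lift_rep_frag_map)
  \<comment> \<open>\<open>v\<close> sees only the (1,0) part of \<open>x\<close>, and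
    \<open>?Q\<close> is left linear over A, so the coefficient \<open>v x\<close> moves
    inside.\<close>
  moreover have "lift_rep (\<lambda>x y. v (?P x) * ?Q y) z = lift_rep (\<lambda>x y. ?Q (v x * y)) z"
    using vV by (intro lift_rep_cong[OF keys_z]) (auto simp: Vec10_eigen_part[OF v] eigen_part_left Vec_iff)
  ultimately have second: "lift_rep (\<lambda>x y. ?Q (v x * y)) z = 0" by simp

  let ?S = "tensor_rel ?A (Omega_pq D J 0 1) (Vec D)"
  have "frag_map (proj_pq D J 0 1) id w \<in> ?S"
    using nabv unfolding tensor_map_def tensor_zero_def w_def by (rule coset_eq_tensor_relD)
  \<comment> \<open>For fixed \<open>\<xi>\<close> this is \<open>id \<otimes> ev\<close> applied
    after tensoring with \<open>\<xi>\<close>; it is balanced because A acts on the values of a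
    field from the left.\<close>
  moreover have "balanced ?A (Omega_pq D J 0 1) (Vec D) (\<lambda>\<omega> u. \<omega> * u \<xi>)"
    by (auto simp: balanced_def Omega_pq_def algebra_simps Vec_def)
  ultimately have "lift_rep (\<lambda>\<omega> u. proj_pq D J 0 1 \<omega> * u \<xi>) w = 0"
    using lift_rep_tensor_rel by (fastforce simp: lift_rep_frag_map)
  moreover have "lift_rep (\<lambda>\<omega> u. proj_pq D J 0 1 \<omega> * u \<xi>) w = lift_rep (\<lambda>\<omega> u. ?Q (\<omega> * u \<xi>)) w"
    using \<xi> by (intro lift_rep_cong[OF keys_w]) (simp add: proj_01 eigen_part_right Vec_iff)
  ultimately have first: "lift_rep (\<lambda>\<omega> u. ?Q (\<omega> * u \<xi>)) w = 0" by simp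

  have "\<xi> \<in> car ?W" using \<xi> by (simp add: Omega_def)
  then have "dif D (ev D (tens ?A (Vec D) ?W v \<xi>)) =
      lift_rep (\<lambda>\<omega> u. \<omega> * ev D (tens ?A (Vec D) ?W u \<xi>)) w +
      lift_rep (\<lambda>x y. ev D (tens ?A (Vec D) ?W v x) * y) z"
    using nabV vV unfolding dual_cov_deriv_def Let_def tensor_lift_eq w_def z_def by blast
  then have "dif D (v \<xi>) =
      lift_rep (\<lambda>\<omega> u. \<omega> * ev D (tens ?A (Vec D) ?W u \<xi>)) w +
      lift_rep (\<lambda>x y. ev D (tens ?A (Vec D) ?W v x) * y) z"
    using ev_tens[OF vV \<xi>] by simp
  also have "lift_rep (\<lambda>\<omega> u. \<omega> * ev D (tens ?A (Vec D) ?W u \<xi>)) w = lift_rep (\<lambda>\<omega> u. \<omega> * u \<xi>) w"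
    using \<xi> by (intro lift_rep_cong[OF keys_w]) (simp add: ev_tens)
  also have "lift_rep (\<lambda>x y. ev D (tens ?A (Vec D) ?W v x) * y) z = lift_rep (\<lambda>x y. v x * y) z"
    using vV by (intro lift_rep_cong[OF keys_z]) (simp add: ev_tens)
  finally have dif_v: "dif D (v \<xi>) = lift_rep (\<lambda>\<omega> u. \<omega> * u \<xi>) w + lift_rep (\<lambda>x y. v x * y) z" .
  \<comment> \<open>\<open>?Q\<close> is known to be additive only on one-forms, so the terms of
    both sums must be one-forms before it can be taken inside.\<close>
  have w_mem: "\<omega> * u \<xi> \<in> forms D 1" if "\<omega> \<in> forms D 1" "u \<in> car (Vec D)" for \<omega> u
    using that \<xi> by (auto simp: Vec_iff)
  have z_mem: "v x * y \<in> forms D 1" if "x \<in> forms D 1" "y \<in> forms D 1" for x y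
    using that vV by (auto simp: Vec_iff)
  have "?Q (lift_rep (\<lambda>\<omega> u. \<omega> * u \<xi>) w) = 0"
    unfolding first[symmetric] using keys_w w_mem
    by (rule lift_rep_hom[where g = ?Q]) (simp_all add: subspace_forms eigen_part_add eigen_part_smul)
  moreover have "?Q (lift_rep (\<lambda>x y. v x * y) z) = 0"
    unfolding second[symmetric] using keys_z z_mem
    by (rule lift_rep_hom[where g = ?Q]) (simp_all add: subspace_forms eigen_part_add eigen_part_smul)
  moreover have "?Q (dif D (v \<xi>)) = ?Q (lift_rep (\<lambda>\<omega> u. \<omega> * u \<xi>) w) + ?Q (lift_rep (\<lambda>x y. v x * y) z)"
    unfolding dif_v using w_mem z_mem
    by (intro eigen_part_add lift_rep_in_subspace[OF subspace_forms keys_w]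
        lift_rep_in_subspace[OF subspace_forms keys_z])
  ultimately have "dbar D J 0 0 (v \<xi>) = 0" by (simp add: dbar_def proj_01[OF v\<xi>(2)])
  then show "holomorphic D J (ev D (tens ?A (Vec D) ?W v (dif D a0)))"
    using v\<xi>(1) ev_tens[OF vV \<xi>] by (simp add: holomorphic_def \<xi>_def)
qed

end
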